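(* Let $\mathbf{k}$ be a commutative ring and $a,b\in\mathbf{k}$. Let $q$ and $u$ be two elements of $\mathbf{k}$ such that $a=(q-1)u$ and $b=-qu^2$. Let $\mathrm{eta}:\mathcal{F}\to\mathrm{QSym}$ be the $\mathbf{k}$-linear map that sends the word $x_\alpha=x_{\alpha_1}x_{\alpha_2}\cdots x_{\alpha_k}\in\mathcal{F}$ to $u^{\ell(\alpha)}\eta_\alpha^{(q)}\in\mathrm{QSym}$ for each composition $\alpha=(\alpha_1,\alpha_2,\ldots,\alpha_k)$. Then $\mathrm{eta}$ is a $\mathbf{k}$-algebra homomorphism from the $\mathbf{k}$-algebra $(\mathcal{F},\#)$ (with multiplication the stufufuffle $\#$ and unity $1$) to the $\mathbf{k}$-algebra $\mathrm{QSym}$.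
   Context: For an integer $m$, $[m]=\{1,2,\ldots,m\}$ (empty if $m\le 0$). A composition is a finite tuple $\alpha=(\alpha_1,\ldots,\alpha_k)$ of positive integers; its length is $\ell(\alpha)=k$, its size is $|\alpha|=\alpha_1+\cdots+\alpha_k$. $\mathrm{Comp}$ is the set of all compositions (including the empty one), and $\mathrm{Comp}_n$ the set of compositions of size $n$. For $\alpha=(\alpha_1,\ldots,\alpha_k)\in\mathrm{Comp}_n$ set $D(\alpha)=\{\alpha_1+\cdots+\alpha_i \mid i\in[k-1]\}\subseteq[n-1]$. $\mathcal{F}$ is the free (noncommutative) $\mathbf{k}$-algebra with generators $x_1,x_2,x_3,\ldots$; it has as $\mathbf{k}$-basis all words in these letters, i.e. the words $x_\gamma:=x_{\gamma_1}x_{\gamma_2}\cdots x_{\gamma_k}$ for all compositions $\gamma=(\gamma_1,\ldots,\gamma_k)$; the empty word is $1$. For $k\in\{0,1,2,\ldots\}$, $\zeta_k:\mathcal{F}\to\mathcal{F}$ is the $\mathbf{k}$-linear map with $\zeta_k(1)=0$ and $\zeta_k(x_iw)=x_{i+k}w$ for each $i\ge 1$ and each word $w$. The stufufuffle $\#:\mathcal{F}\times\mathcal{F}\to\mathcal{F}$ is the $\mathbf{k}$-bilinear map defined recursively by $1\#w=w$ and $w\#1=w$ for any word $w$, and $$(x_iu)\#(x_jv)=x_i\bigl(u\#(x_jv)\bigr)+x_j\bigl((x_iu)\#v\bigr)+a\,x_{i+j}(u\#v)+b\,\zeta_{i+j}(u\#v)$$ for any $i,j\ge 1$ and any words $u,v$.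 (This operation is associative and commutative with neutral element $1$, so $(\mathcal{F},\#)$ is a commutative $\mathbf{k}$-algebra.) $\mathrm{QSym}$ is the $\mathbf{k}$-algebra of quasisymmetric functions over $\mathbf{k}$ in commuting indeterminates $t_1,t_2,t_3,\ldots$: the $\mathbf{k}$-subalgebra of $\mathbf{k}[[t_1,t_2,\ldots]]$ with basis $(M_\alpha)_{\alpha\in\mathrm{Comp}}$, where $M_\alpha=\sum_{i_1<\cdots<i_\ell}t_{i_1}^{\alpha_1}\cdots t_{i_\ell}^{\alpha_\ell}$ for $\alpha=(\alpha_1,\ldots,\alpha_\ell)$. For $\alpha\in\mathrm{Comp}_n$, $\eta_\alpha^{(q)}=\sum_{\beta\in\mathrm{Comp}_n;\ D(\beta)\subseteq D(\alpha)}(q+1)^{\ell(\beta)}M_\beta$. *)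

theory Defs
  imports Main "HOL-Library.Poly_Mapping"
begin

text \<open>
  Base rings have sort \<open>{comm_ring, comm_monoid_mult}\<close>: these are exactly the commutative rings
  with unity. The class \<open>comm_ring_1\<close> would additionally impose \<open>0 \<noteq> 1\<close> and so exclude
  the zero ring.
\<close>

section \<open>Compositions\<close>

definition Comp :: "nat list set" where
  "Comp = {\<alpha>. 0 \<notin> set \<alpha>}"

definition Comp_of_size :: "nat \<Rightarrow> nat list set" where
  "Comp_of_size n = {\<alpha> \<in> Comp. sum_list \<alpha> = n}"

definition partial_sums :: "nat list \<Rightarrow> nat set" where
  "partial_sums \<alpha> = {sum_list (take i \<alpha>) | i. i \<in> {1..length \<alpha> - 1}}"

lemma finite_Comp_of_size: "finite (Comp_of_size n)"
proof (rule finite_subset)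
  have len: "length \<alpha> \<le> sum_list \<alpha>" if "0 \<notin> set \<alpha>" for \<alpha> :: "nat list"
    using that by (induction \<alpha>) auto
  show "Comp_of_size n \<subseteq> {\<alpha>. set \<alpha> \<subseteq> {..n} \<and> length \<alpha> \<le> n}"
    using len by (auto simp: Comp_of_size_def Comp_def intro: member_le_sum_list)
  show "finite {\<alpha>. set \<alpha> \<subseteq> {..n} \<and> length \<alpha> \<le> n}"
    by (rule finite_lists_length_le) simp
qed


section \<open>The free algebra\<close>

text \<open>
  A finitely supported function \<open>f\<close> on lists of naturals stands for the linear combination
  \<open>\<Sum>\<gamma>. f(\<gamma>) x\<^sub>\<gamma>\<close> of words. Only lists of positive numbers index words of the free
  algebra, so the algebra itself is the carrier \<open>free_alg\<close>.
\<close>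

type_synonym 'k words = "nat list \<Rightarrow>\<^sub>0 'k"

abbreviation lookup :: "('a \<Rightarrow>\<^sub>0 'b::zero) \<Rightarrow> 'a \<Rightarrow> 'b" where
  "lookup \<equiv> Poly_Mapping.lookup"

abbreviation keys :: "('a \<Rightarrow>\<^sub>0 'b::zero) \<Rightarrow> 'a set" where
  "keys \<equiv> Poly_Mapping.keys"

definition free_alg :: "'k::{comm_ring, comm_monoid_mult} words set" where
  "free_alg = {f. keys f \<subseteq> Comp}"

definition word :: "nat list \<Rightarrow> 'k::{comm_ring, comm_monoid_mult} words" where
  "word \<gamma> = Poly_Mapping.single \<gamma> 1"

definition scale :: "'k::{comm_ring, comm_monoid_mult} \<Rightarrow> 'k words \<Rightarrow> 'k words" where
  "scale c f = Poly_Mapping.map ((*) c) f"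

text \<open>
  Linear extension of a map given on words; the first argument is the scalar multiplication
  of the target module.
\<close>

definition lin_ext ::
  "('k::{comm_ring, comm_monoid_mult} \<Rightarrow> 'm \<Rightarrow> 'm) \<Rightarrow> (nat list \<Rightarrow> 'm) \<Rightarrow> 'k words \<Rightarrow> 'm::comm_monoid_add"
  where "lin_ext sc h f = (\<Sum>\<gamma>\<in>keys f. sc (lookup f \<gamma>) (h \<gamma>))"

definition bilin_ext ::
  "(nat list \<Rightarrow> nat list \<Rightarrow> 'k::{comm_ring, comm_monoid_mult} words) \<Rightarrow> 'k words \<Rightarrow> 'k words \<Rightarrow> 'k words"
  where "bilin_ext h f g = lin_ext scale (\<lambda>v. lin_ext scale (\<lambda>w. h v w) g) f"

definition conc :: "'k::{comm_ring, comm_monoid_mult} words \<Rightarrow> 'k words \<Rightarrow> 'k words" (infixl "\<cdot>" 70)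
  where "f \<cdot> g = bilin_ext (\<lambda>v w. word (v @ w)) f g"

abbreviation letter :: "nat \<Rightarrow> 'k::{comm_ring, comm_monoid_mult} words" where
  "letter i \<equiv> word [i]"

fun zeta_word :: "nat \<Rightarrow> nat list \<Rightarrow> 'k::{comm_ring, comm_monoid_mult} words" where
  "zeta_word k [] = 0"
| "zeta_word k (i # w) = word ((i + k) # w)"

definition zeta :: "nat \<Rightarrow> 'k::{comm_ring, comm_monoid_mult} words \<Rightarrow> 'k words" where
  "zeta k = lin_ext scale (zeta_word k)"

fun stufufuffle_word ::
  "'k::{comm_ring, comm_monoid_mult} \<Rightarrow> 'k \<Rightarrow> nat list \<Rightarrow> nat list \<Rightarrow> 'k words" where
  "stufufuffle_word a b [] w = word w"
| "stufufuffle_word a b (i # v) [] = word (i # v)"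
| "stufufuffle_word a b (i # v) (j # w) =
     letter i \<cdot> stufufuffle_word a b v (j # w)
   + letter j \<cdot> stufufuffle_word a b (i # v) w
   + scale a (letter (i + j) \<cdot> stufufuffle_word a b v w)
   + scale b (zeta (i + j) (stufufuffle_word a b v w))"

definition stufufuffle ::
  "'k::{comm_ring, comm_monoid_mult} \<Rightarrow> 'k \<Rightarrow> 'k words \<Rightarrow> 'k words \<Rightarrow> 'k words" where
  "stufufuffle a b = bilin_ext (stufufuffle_word a b)"


section \<open>Formal power series in countably many indeterminates\<close>

text \<open>
  A monomial is its finitely supported exponent function. The indeterminates are indexed by
  all naturals: index \<open>i\<close> stands for \<open>t\<^bsub>i+1\<^esub>\<close>, which preserves the order of
  the indeterminates.
\<close>

type_synonym monom = "nat \<Rightarrow>\<^sub>0 nat"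

typedef 'k series = "UNIV :: (monom \<Rightarrow> 'k) set"
  morphisms coeff Series ..

declare Series_inverse [simplified, simp] coeff_inverse [simp]

lemma series_eqI: "(\<And>m. coeff f m = coeff g m) \<Longrightarrow> f = g"
  by (metis coeff_inverse ext)

definition splits :: "monom \<Rightarrow> (monom \<times> monom) set" where
  "splits m = {(m1, m2). m1 + m2 = m}"

lemma finite_splits: "finite (splits m)"
proof -
  define B where "B = {m' :: monom. \<forall>i. lookup m' i \<le> lookup m i}"
  define N where "N = Max (insert 0 (lookup m ` keys m))"
  have bound: "lookup m i \<le> N" for i
    unfolding N_def by (cases "i \<in> keys m") (simp_all add: in_keys_iff)
  define T where "T = {f :: nat \<Rightarrow> nat. \<forall>i. (i \<in> keys m \<longrightarrow> f i \<in> {..N}) \<and> (i \<notin> keys m \<longrightarrow> f i = 0)}"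
  have "finite T"
    unfolding T_def by (rule finite_set_of_finite_funs) simp_all
  moreover have "lookup ` B \<subseteq> T"
  proof
    fix f
    assume "f \<in> lookup ` B"
    then have f: "f i \<le> lookup m i" for i
      by (auto simp: B_def)
    have "f i \<le> N" for i
      using order_trans[OF f bound] .
    moreover have "f i = 0" if "i \<notin> keys m" for i
      using f[of i] that by (simp add: in_keys_iff)
    ultimately show "f \<in> T"
      by (simp add: T_def)
  qed
  ultimately have "finite (lookup ` B)"
    by (rule finite_subset[rotated])
  then have "finite B"
    by (rule finite_imageD) (simp add: inj_on_def)
  moreover have "splits m \<subseteq> B \<times> B"
    by (auto simp: splits_def B_def lookup_add)
  ultimately show ?thesis
    using finite_subset[of "splits m" "B \<times> B"] by simp
qed

instantiation series :: ("{comm_ring, comm_monoid_mult}") "{comm_ring, comm_monoid_mult}"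
begin

definition "0 = Series (\<lambda>m. 0)"
definition "1 = Series (\<lambda>m. if m = 0 then 1 else 0)"
definition "f + g = Series (\<lambda>m. coeff f m + coeff g m)"
definition "- f = Series (\<lambda>m. - coeff f m)"
definition "f - g = Series (\<lambda>m. coeff f m - coeff g m)"
definition "f * g = Series (\<lambda>m. \<Sum>(m1, m2)\<in>splits m. coeff f m1 * coeff g m2)"

instance
proof
  fix f g h :: "'a series"
  note defs = zero_series_def one_series_def plus_series_def uminus_series_def
    minus_series_def times_series_def
  show "f + g + h = f + (g + h)" "f + g = g + f" "0 + f = f" "- f + f = 0" "f - g = f + - g"
    by (simp_all add: defs algebra_simps)
  show comm: "f * g = g * f" for f g :: "'a series"
  proof (rule series_eqI)
    fix m
    have "(\<Sum>(m1, m2)\<in>splits m. coeff f m1 * coeff g m2)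
        = (\<Sum>(m1, m2)\<in>splits m. coeff g m1 * coeff f m2)"
      by (rule sum.reindex_bij_witness[of _ prod.swap prod.swap])
        (auto simp: splits_def ac_simps)
    then show "coeff (f * g) m = coeff (g * f) m"
      by (simp add: defs)
  qed
  show "(f + g) * h = f * h + g * h"
    by (simp add: defs distrib_right sum.distrib split_def)
  show "1 * f = f"
  proof (rule series_eqI)
    fix m
    have "(\<Sum>(m1, m2)\<in>splits m. coeff 1 m1 * coeff f m2)
        = (\<Sum>(m1, m2)\<in>{(0, m)}. coeff 1 m1 * coeff f m2)"
      by (rule sum.mono_neutral_right[OF finite_splits]) (auto simp: splits_def defs split: if_splits)
    then show "coeff (1 * f) m = coeff f m"
      by (simp add: defs)
  qed
  show "f * g * h = f * (g * h)"
  proof (rule series_eqI)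
    fix m
    have "(\<Sum>(p, z)\<in>splits m. (\<Sum>(x, y)\<in>splits p. coeff f x * coeff g y) * coeff h z)
        = (\<Sum>(s, t)\<in>Sigma (splits m) (\<lambda>s. splits (fst s)).
             coeff f (fst t) * coeff g (snd t) * coeff h (snd s))"
      by (subst sum.Sigma[symmetric])
        (auto simp: finite_splits split_def sum_distrib_right)
    also have "\<dots> = (\<Sum>(s, t)\<in>Sigma (splits m) (\<lambda>s. splits (snd s)).
             coeff f (fst s) * (coeff g (fst t) * coeff h (snd t)))"
      by (rule sum.reindex_bij_witness[of _
            "\<lambda>((x, p), (y, z)). ((x + y, z), (x, y))" "\<lambda>((p, z), (x, y)). ((x, y + z), (y, z))"])
        (auto simp: splits_def ac_simps)
    also have "\<dots> = (\<Sum>(x, p)\<in>splits m. coeff f x * (\<Sum>(y, z)\<in>splits p. coeff g y * coeff h z))"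
      by (subst sum.Sigma[symmetric])
        (auto simp: finite_splits split_def sum_distrib_left)
    finally show "coeff (f * g * h) m = coeff (f * (g * h)) m"
      by (simp add: defs)
  qed
qed

end

definition series_scale :: "'k::{comm_ring, comm_monoid_mult} \<Rightarrow> 'k series \<Rightarrow> 'k series" where
  "series_scale c f = Series (\<lambda>m. c * coeff f m)"


section \<open>Quasisymmetric functions\<close>

definition monom_of :: "nat list \<Rightarrow> nat list \<Rightarrow> monom" where
  "monom_of is \<alpha> = (\<Sum>(i, e)\<leftarrow>zip is \<alpha>. Poly_Mapping.single i e)"

text \<open>
  Each monomial occurs in the sum defining \<open>M\<^sub>\<alpha>\<close> at most once (lemma \<open>monom_of_inj\<close>
  below), so all coefficients of \<open>M\<^sub>\<alpha>\<close> are 0 or 1.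
\<close>

definition M :: "nat list \<Rightarrow> 'k::{comm_ring, comm_monoid_mult} series" where
  "M \<alpha> = Series (\<lambda>m. if \<exists>is. length is = length \<alpha> \<and> sorted_wrt (<) is \<and> m = monom_of is \<alpha>
                       then 1 else 0)"

lemma keys_monom_of:
  assumes "\<alpha> \<in> Comp" "length is = length \<alpha>"
  shows "keys (monom_of is \<alpha>) = set is"
  using assms(2,1)
proof (induction "is" \<alpha> rule: list_induct2)
  case Nil
  then show ?case by (simp add: monom_of_def)
next
  case (Cons i "is" e \<alpha>)
  then have "keys (monom_of is \<alpha>) = set is" "e \<noteq> 0"
    by (auto simp: Comp_def)
  moreover have "monom_of (i # is) (e # \<alpha>) = Poly_Mapping.single i e + monom_of is \<alpha>"
    by (simp add: monom_of_def)
  ultimately have "x \<in> keys (monom_of (i # is) (e # \<alpha>)) \<longleftrightarrow> x = i \<or> x \<in> set is" for x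
    by (cases "x = i") (simp_all add: in_keys_iff lookup_add lookup_single flip: \<open>keys _ = _\<close>)
  then show ?case
    by auto
qed

lemma monom_of_inj:
  assumes "\<alpha> \<in> Comp" "length is = length \<alpha>" "length js = length \<alpha>"
    and "sorted_wrt (<) is" "sorted_wrt (<) js" "monom_of is \<alpha> = monom_of js \<alpha>"
  shows "is = js"
proof (rule strict_sorted_equal)
  show "set is = set js"
    using keys_monom_of[OF assms(1,2)] keys_monom_of[OF assms(1,3)] assms(6) by simp
qed (use assms in auto)

definition QSym :: "'k::{comm_ring, comm_monoid_mult} series set" where
  "QSym = {\<Sum>\<alpha>\<in>A. series_scale (c \<alpha>) (M \<alpha>) | A c. finite A \<and> A \<subseteq> Comp}"

definition eta_qsym :: "'k::{comm_ring, comm_monoid_mult} \<Rightarrow> nat list \<Rightarrow> 'k series" where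
  "eta_qsym q \<alpha> =
     (\<Sum>\<beta>\<in>{\<beta> \<in> Comp_of_size (sum_list \<alpha>). partial_sums \<beta> \<subseteq> partial_sums \<alpha>}.
        series_scale ((q + 1) ^ length \<beta>) (M \<beta>))"

definition eta :: "'k::{comm_ring, comm_monoid_mult} \<Rightarrow> 'k \<Rightarrow> 'k words \<Rightarrow> 'k series" where
  "eta q u = lin_ext series_scale (\<lambda>\<alpha>. series_scale (u ^ length \<alpha>) (eta_qsym q \<alpha>))"


section \<open>Homomorphisms\<close>

text \<open>
  Homomorphisms of unital algebras over \<open>'k\<close> between carriers \<open>A\<close> and \<open>B\<close>, each with its
  scalar multiplication, product and unity; addition is the one of the ambient type.
\<close>

definition algebra_hom ::
  "'a::plus set \<Rightarrow> ('k \<Rightarrow> 'a \<Rightarrow> 'a) \<Rightarrow> ('a \<Rightarrow> 'a \<Rightarrow> 'a) \<Rightarrow> 'a \<Rightarrow>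
   'b::plus set \<Rightarrow> ('k \<Rightarrow> 'b \<Rightarrow> 'b) \<Rightarrow> ('b \<Rightarrow> 'b \<Rightarrow> 'b) \<Rightarrow> 'b \<Rightarrow> ('a \<Rightarrow> 'b) \<Rightarrow> bool" where
  "algebra_hom A scA mulA oneA B scB mulB oneB h \<longleftrightarrow>
     h ` A \<subseteq> B \<and>
     (\<forall>x\<in>A. \<forall>y\<in>A. h (x + y) = h x + h y) \<and>
     (\<forall>c. \<forall>x\<in>A. h (scA c x) = scB c (h x)) \<and>
     (\<forall>x\<in>A. \<forall>y\<in>A. h (mulA x y) = mulB (h x) (h y)) \<and>
     h oneA = oneB"


section \<open>Values on basis words\<close>

lemma scale_zero [simp]: "scale 0 f = 0"
  by (rule poly_mapping_eqI) (simp add: scale_def map.rep_eq when_def)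

lemma scale_one [simp]: "scale 1 f = f"
  by (rule poly_mapping_eqI) (simp add: scale_def map.rep_eq when_def)

lemma series_scale_zero [simp]: "series_scale 0 f = 0"
  by (simp add: series_scale_def zero_series_def)

lemma series_scale_one [simp]: "series_scale 1 f = f"
  by (simp add: series_scale_def)

lemma lin_ext_word:
  fixes sc :: "'k::{comm_ring, comm_monoid_mult} \<Rightarrow> 'm \<Rightarrow> 'm::comm_monoid_add"
  assumes "\<And>y. sc 0 y = 0" "\<And>y. sc 1 y = y"
  shows "lin_ext sc h (word \<gamma>) = h \<gamma>"
proof (cases "(1::'k) = 0")
  case True
  then have "h \<gamma> = 0"
    using assms by metis
  then show ?thesis
    using True by (simp add: lin_ext_def word_def)
next
  case False
  then show ?thesis
    using assms by (simp add: lin_ext_def word_def)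
qed

lemma stufufuffle_words: "stufufuffle a b (word v) (word w) = stufufuffle_word a b v w"
  by (simp add: stufufuffle_def bilin_ext_def lin_ext_word)

lemma letter_conc_word: "letter i \<cdot> word w = word (i # w)"
  by (simp add: conc_def bilin_ext_def lin_ext_word)

lemma zeta_word_eq: "zeta k (word w) = zeta_word k w"
  by (simp add: zeta_def lin_ext_word)

lemma eta_word: "eta q u (word \<alpha>) = series_scale (u ^ length \<alpha>) (eta_qsym q \<alpha>)"
  by (simp add: eta_def lin_ext_word)

end

theory Submission
  imports Defs
begin

text \<open>
  Coarsening a composition amounts to merging runs of consecutive letters, so
  \<open>\<eta>\<^sub>\<alpha>\<close> is also the sum of \<open>(q + 1)\<^sup>d t\<^bsub>g(1)\<^esub>\<^bsup>\<alpha>(1)\<^esup> \<cdots> t\<^bsub>g(k)\<^esub>\<^bsup>\<alpha>(k)\<^esup>\<close>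
  over all weakly increasing \<open>g\<close>, where \<open>d\<close> is the number of distinct values of \<open>g\<close>.
  In a finite alphabet this sum can be built up by adding one smallest variable \<open>x\<close> at a time.
  Let \<open>B\<close> be the evaluation \<open>x\<^sub>\<alpha> \<mapsto> u\<^bsup>\<ell>(\<alpha>)\<^esup> \<eta>\<^sub>\<alpha>\<close> in the old alphabet, and let
  \<open>A\<close> be the same sum in the new alphabet, except that using \<open>x\<close> does not cost a factor
  \<open>q + 1\<close>. Then \<open>A(x\<^sub>i w) = u x\<^sup>i A(w) + B(x\<^sub>i w)\<close>. The terms that use \<open>x\<close> make up
  \<open>A - B\<close>, so the new evaluation is \<open>B + (q + 1)(A - B) = A + q(A - B)\<close>.

  If \<open>B\<close> is multiplicative for the stufufuffle, then
  \<open>A(v # w) = A(v) A(w) + q (A - B)(v) (A - B)(w)\<close>. This is an induction along the recursion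
  of the stufufuffle: the difference \<open>A - B\<close> turns prepending the letter \<open>x\<^sub>k\<close> to \<open>f\<close> into
  \<open>u x\<^sup>k A(f)\<close>, and it turns \<open>\<zeta>\<^sub>k\<close> into multiplication by \<open>x\<^sup>k\<close>, after which the four
  terms of the recursion add up to the claim because \<open>a = (q - 1)u\<close> and \<open>b = -q u\<^sup>2\<close>
  (lemma \<open>prefix_sum_stufufuffle\<close>). The displayed formula makes
  \<open>A + q(A - B)\<close> multiplicative again, and so the evaluation in every finite alphabet is
  multiplicative (lemma \<open>stufufuffle_hom_eta_alphabet\<close>).

  A monomial involves finitely many variables, and so do all its factors. Hence a coefficient of
  a product can be computed in a finite alphabet, where the evaluation has the same coefficients
  as the map \<open>eta\<close> (lemma \<open>coeff_eta_word_eq_alphabet\<close>).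
\<close>


section \<open>Linear extensions\<close>

lemma lookup_scale [simp]: "lookup (scale c f) \<gamma> = c * lookup f \<gamma>"
  by (simp add: scale_def map.rep_eq when_def)

lemma coeff_simps [simp]:
  "coeff 0 m = 0"
  "coeff 1 m = (if m = 0 then 1 else 0)"
  "coeff (f + g) m = coeff f m + coeff g m"
  "coeff (f - g) m = coeff f m - coeff g m"
  "coeff (series_scale c f) m = c * coeff f m"
  by (simp_all add: zero_series_def one_series_def plus_series_def minus_series_def
      series_scale_def)

lemma coeff_times: "coeff (f * g) m = (\<Sum>(m1, m2)\<in>splits m. coeff f m1 * coeff g m2)"
  by (simp add: times_series_def)

lemma coeff_sum [simp]: "coeff (sum f A) m = (\<Sum>x\<in>A. coeff (f x) m)"
  by (induction A rule: infinite_finite_induct) auto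

text \<open>
  Module laws over a ring in which \<open>0 = 1\<close> is possible; the linear extensions below have
  values in the words and in the series alike.
\<close>

locale scalar_action =
  fixes sc :: "'k::{comm_ring, comm_monoid_mult} \<Rightarrow> 'm \<Rightarrow> 'm::comm_monoid_add"
  assumes sc_zero: "sc 0 y = 0"
    and sc_one: "sc 1 y = y"
    and sc_add_left: "sc (c + d) y = sc c y + sc d y"
    and sc_mult: "sc (c * d) y = sc c (sc d y)"
    and sc_add_right: "sc c (y + z) = sc c y + sc c z"
begin

lemma sc_zero_right: "sc c 0 = 0"
  by (metis mult_zero_right sc_mult sc_zero)

lemma sc_sum: "sc c (sum h A) = (\<Sum>x\<in>A. sc c (h x))"
  by (induction A rule: infinite_finite_induct) (auto simp: sc_zero_right sc_add_right)

lemma lin_ext_superset: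
  assumes "finite S" "keys f \<subseteq> S"
  shows "lin_ext sc h f = (\<Sum>\<gamma>\<in>S. sc (lookup f \<gamma>) (h \<gamma>))"
  unfolding lin_ext_def
  by (rule sum.mono_neutral_left) (use assms in \<open>auto simp: in_keys_iff sc_zero\<close>)

lemma lin_ext_zero: "lin_ext sc h 0 = 0"
  by (simp add: lin_ext_def)

lemma lin_ext_add: "lin_ext sc h (f + g) = lin_ext sc h f + lin_ext sc h g"
proof -
  have "keys (f + g) \<subseteq> keys f \<union> keys g"
    by (rule Poly_Mapping.keys_add)
  then show ?thesis
    by (simp add: lin_ext_superset[of "keys f \<union> keys g"] lookup_add sc_add_left sum.distrib)
qed

lemma lin_ext_scale: "lin_ext sc h (scale c f) = sc c (lin_ext sc h f)"
proof -
  have "keys (scale c f) \<subseteq> keys f"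
    by (auto simp: in_keys_iff)
  then show ?thesis
    by (simp add: lin_ext_superset[of "keys f"] sc_mult sc_sum)
qed

lemma lin_ext_sum: "lin_ext sc h (sum f A) = (\<Sum>x\<in>A. lin_ext sc h (f x))"
  by (induction A rule: infinite_finite_induct) (auto simp: lin_ext_zero lin_ext_add)

lemma lin_ext_word [simp]: "lin_ext sc h (word \<gamma>) = h \<gamma>"
  by (rule Defs.lin_ext_word) (simp_all add: sc_zero sc_one)

lemma lin_ext_lin_ext:
  "lin_ext sc h (lin_ext scale g f) = lin_ext sc (\<lambda>\<gamma>. lin_ext sc h (g \<gamma>)) f"
  by (simp add: lin_ext_def[of scale] lin_ext_sum lin_ext_scale lin_ext_def[of sc _ f])

end

interpretation series: scalar_action series_scale
  by unfold_locales (auto intro!: series_eqI simp: algebra_simps)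

lemma lin_ext_cong:
  assumes "\<And>\<gamma>. \<gamma> \<in> keys f \<Longrightarrow> g \<gamma> = h \<gamma>"
  shows "lin_ext sc g f = lin_ext sc h f"
  using assms by (simp add: lin_ext_def)

lemma letter_conc: "letter i \<cdot> f = lin_ext scale (\<lambda>w. word (i # w)) f"
  by (simp add: conc_def bilin_ext_def Defs.lin_ext_word)

text \<open>
  Scalars become the constant series \<open>series_scale c 1\<close>, so that identities between values of
  linear maps are identities in one commutative ring.
\<close>

lemma series_scale_eq_times: "series_scale c f = series_scale c 1 * f"
proof (rule series_eqI)
  fix m
  have "coeff (series_scale c 1 * f) m
      = (\<Sum>(m1, m2)\<in>{(0, m)}. coeff (series_scale c 1) m1 * coeff f m2)"
    unfolding coeff_times
    by (rule sum.mono_neutral_right[OF finite_splits]) (auto simp: splits_def split: if_splits)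
  then show "coeff (series_scale c f) m = coeff (series_scale c 1 * f) m"
    by simp
qed

lemma series_scale_times_right: "series_scale c (r * f) = r * series_scale c f"
  by (metis series_scale_eq_times mult.left_commute)

lemma constant_simps:
  "series_scale (c * d) 1 = series_scale c 1 * series_scale d 1"
  "series_scale (c - d) 1 = series_scale c 1 - series_scale d 1"
  "series_scale (- c) 1 = - series_scale c 1"
proof -
  show "series_scale (c * d) 1 = series_scale c 1 * series_scale d 1"
    by (simp only: series.sc_mult series_scale_eq_times[of c "series_scale d 1"])
  show diff: "series_scale (c - d) 1 = series_scale c 1 - series_scale d 1" for c d :: 'a
    by (rule series_eqI) (simp add: algebra_simps)
  show "series_scale (- c) 1 = - series_scale c 1"
    using diff[of 0 c] by simp
qed

lemma lin_ext_times: "lin_ext series_scale (\<lambda>w. r * h w) f = r * lin_ext series_scale h f"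
  by (simp add: lin_ext_def sum_distrib_left series_scale_times_right)

lemma lin_ext_diff:
  "lin_ext series_scale (\<lambda>w. g w - h w) f = lin_ext series_scale g f - lin_ext series_scale h f"
proof -
  have "series_scale c (x - y) = series_scale c x - series_scale c y" for c :: 'a and x y
    by (rule series_eqI) (simp add: algebra_simps)
  then show ?thesis
    by (simp add: lin_ext_def sum_subtractf)
qed


section \<open>Evaluation in a finite alphabet\<close>

text \<open>
  The map \<open>A\<close> of the introduction: the value at \<open>w\<close> is the sum of
  \<open>U\<^bsup>\<ell>(p)\<^esup> x\<^bsup>|p|\<^esup> B(s)\<close> over all factorizations \<open>w = p s\<close>, since the letters that
  receive the smallest variable form a prefix.
\<close>

fun prefix_sum :: "'r \<Rightarrow> 'r \<Rightarrow> (nat list \<Rightarrow> 'r) \<Rightarrow> nat list \<Rightarrow> 'r::{comm_ring, comm_monoid_mult}" where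
  "prefix_sum U x B [] = B []"
| "prefix_sum U x B (i # w) = U * x ^ i * prefix_sum U x B w + B (i # w)"

text \<open>
  The image of a word of positive letters under \<open>eta\<close>, restricted to a finite alphabet whose
  smallest variable is the head of the list; \<open>Q\<close> and \<open>U\<close> stand for \<open>q\<close> and \<open>u\<close>.
\<close>

fun eta_alphabet :: "'r \<Rightarrow> 'r \<Rightarrow> 'r list \<Rightarrow> nat list \<Rightarrow> 'r::{comm_ring, comm_monoid_mult}" where
  "eta_alphabet U Q [] w = (if w = [] then 1 else 0)"
| "eta_alphabet U Q (x # xs) w =
     (let A = prefix_sum U x (eta_alphabet U Q xs) w; B = eta_alphabet U Q xs w
      in A + Q * (A - B))"

lemma eta_alphabet_Nil: "eta_alphabet U Q xs [] = 1"
  by (induction xs) (auto simp: Let_def)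

definition stufufuffle_hom ::
  "'k::{comm_ring, comm_monoid_mult} \<Rightarrow> 'k \<Rightarrow> (nat list \<Rightarrow> 'k series) \<Rightarrow> bool" where
  "stufufuffle_hom a b B \<longleftrightarrow>
     (\<forall>v w. lin_ext series_scale B (stufufuffle_word a b v w) = B v * B w)"

text \<open>
  The correction term \<open>Q (A v - B v) (A w - B w)\<close> is forced: if \<open>C = A + Q (A - B)\<close> and \<open>B\<close>
  are both to be multiplicative, expanding \<open>C v * C w\<close> and cancelling \<open>Q + 1\<close> leaves
  precisely this value of \<open>A\<close> at the stufufuffle of \<open>v\<close> and \<open>w\<close>. Proving it directly avoids
  the division.
\<close>

lemma prefix_sum_stufufuffle:
  fixes q u :: "'k::{comm_ring, comm_monoid_mult}" and x :: "'k series"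
  assumes a: "a = (q - 1) * u" and b: "b = - q * u ^ 2"
    and B: "stufufuffle_hom a b B" and B_Nil: "B [] = 1"
  defines "U \<equiv> series_scale u 1" and "Q \<equiv> series_scale q 1"
  defines "A \<equiv> prefix_sum U x B"
  shows "lin_ext series_scale A (stufufuffle_word a b v w)
           = A v * A w + Q * ((A v - B v) * (A w - B w))"
  using a b B
proof (induction a b v w rule: stufufuffle_word.induct)
  case (1 a b w)
  then show ?case by (simp add: A_def B_Nil)
next
  case (2 a b i v)
  then show ?case by (simp add: A_def B_Nil)
next
  case (3 a b i v j w)
  \<comment> \<open>The recursion of the stufufuffle changes first letters, so it is easiest to follow on \<open>D\<close>,
    which collects the terms whose first letter receives \<open>x\<close>; \<open>B\<close> is known already.\<close>
  define D where "D w = A w - B w" for w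
  define P where "P = i # v"
  define R where "R = j # w"
  let ?A = "lin_ext series_scale A" and ?B = "lin_ext series_scale B"
    and ?D = "lin_ext series_scale D"
  have A_eq: "A w = D w + B w" for w
    by (simp add: D_def)
  have D_ext: "?D f = ?A f - ?B f" for f
    unfolding D_def by (rule lin_ext_diff)
  have D_Cons: "D (k # w) = U * x ^ k * A w" for k w
    by (simp add: D_def A_def)
  have D_letter: "?D (letter k \<cdot> f) = U * x ^ k * ?A f" for k f
    by (simp add: letter_conc series.lin_ext_lin_ext D_Cons lin_ext_times)
  have "?D (zeta_word k w) = x ^ k * D w" for k w
    by (cases w) (simp_all add: D_Cons series.lin_ext_zero power_add ac_simps,
        simp add: D_def A_def)
  then have D_zeta: "?D (zeta k f) = x ^ k * ?D f" for k f
    by (simp add: zeta_def series.lin_ext_lin_ext lin_ext_times)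
  have hom: "?B (stufufuffle_word a b v w) = B v * B w" for v w
    using 3 by (simp add: stufufuffle_hom_def)
  have IH: "?A (stufufuffle_word a b v R) = A v * A R + Q * (D v * D R)"
    "?A (stufufuffle_word a b P w) = A P * A w + Q * (D P * D w)"
    "?A (stufufuffle_word a b v w) = A v * A w + Q * (D v * D w)"
    using 3 by (simp_all add: D_def P_def R_def)
  have "series_scale a 1 = (Q - 1) * U"
    using 3 by (simp add: Q_def U_def constant_simps)
  then have scale_a: "series_scale a f = (Q - 1) * U * f" for f
    by (simp add: series_scale_eq_times[of a f])
  have "series_scale b 1 = - Q * U * U"
    using 3 by (simp add: Q_def U_def constant_simps power2_eq_square mult.assoc)
  then have scale_b: "series_scale b f = - Q * U * U * f" for f
    by (simp add: series_scale_eq_times[of b f])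
  have D_word: "D P = U * x ^ i * A v" "D R = U * x ^ j * A w"
    by (simp_all add: P_def R_def D_Cons)
  have "?D (stufufuffle_word a b P R) =
      U * x ^ i * ?A (stufufuffle_word a b v R)
    + U * x ^ j * ?A (stufufuffle_word a b P w)
    + (Q - 1) * U * (U * x ^ (i + j) * ?A (stufufuffle_word a b v w))
    + - Q * U * U * (x ^ (i + j) * (?A (stufufuffle_word a b v w) - ?B (stufufuffle_word a b v w)))"
    by (simp only: P_def R_def stufufuffle_word.simps series.lin_ext_add series.lin_ext_scale
        D_letter D_zeta D_ext[of "stufufuffle_word a b v w"] scale_a scale_b)
  \<comment> \<open>Write \<open>D R + B R\<close> for \<open>A R\<close>, and likewise for \<open>P\<close>. Apart from \<open>D P * B R + B P * D R\<close>
    everything is a multiple of \<open>U\<^sup>2 x\<^bsup>i+j\<^esup>\<close>; the terms with \<open>D v\<close> or \<open>D w\<close> cancel, and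
    \<open>(Q + 1) (A v) (A w)\<close> remains.\<close>
  also have "\<dots> = D P * D R + Q * (D P * D R) + D P * B R + B P * D R"
    unfolding IH hom A_eq[of P] A_eq[of R] D_word unfolding D_def
    by (simp add: algebra_simps power_add)
  finally have "?D (stufufuffle_word a b P R) = \<dots>" .
  then have "?A (stufufuffle_word a b P R)
     = (D P * D R + Q * (D P * D R) + D P * B R + B P * D R) + B P * B R"
    by (simp add: D_ext hom diff_eq_eq)
  also have "\<dots> = (D P + B P) * (D R + B R) + Q * (D P * D R)"
    by (simp add: algebra_simps)
  finally show ?case
    by (simp add: P_def R_def D_def)
qed

text \<open>
  In the empty alphabet only the empty word survives, and every term of the recursion is killed;
  afterwards variables are added one at a time.
\<close>

lemma stufufuffle_hom_eta_alphabet: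
  fixes q u :: "'k::{comm_ring, comm_monoid_mult}"
  assumes a: "a = (q - 1) * u" and b: "b = - q * u ^ 2"
  shows "stufufuffle_hom a b (eta_alphabet (series_scale u 1) (series_scale q 1) xs)"
proof (induction xs)
  case Nil
  define E where "E = eta_alphabet (series_scale u 1) (series_scale q 1) []"
  have E_Cons: "E (i # w) = 0" for i w
    by (simp add: E_def)
  have zero: "lin_ext series_scale (\<lambda>w. 0) f = 0" for f
    using lin_ext_times[of 0 "\<lambda>_. 0" f] by simp
  have letter: "lin_ext series_scale E (letter i \<cdot> f) = 0" for i f
    by (simp add: letter_conc series.lin_ext_lin_ext E_Cons zero)
  have "lin_ext series_scale E (zeta_word i w) = 0" for i w
    by (cases w) (simp_all add: E_Cons series.lin_ext_zero)
  then have zeta: "lin_ext series_scale E (zeta i f) = 0" for i f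
    by (simp add: zeta_def series.lin_ext_lin_ext zero)
  have "lin_ext series_scale E (stufufuffle_word a b v w) = E v * E w" for v w
    by (cases v; cases w)
      (simp_all add: E_Cons letter zeta series.lin_ext_add series.lin_ext_scale
        series.sc_zero_right, simp_all add: E_def)
  then show ?case
    unfolding stufufuffle_hom_def E_def by blast
next
  case (Cons x xs)
  define U where "U = series_scale u 1"
  define Q where "Q = series_scale q 1"
  define B where "B = eta_alphabet U Q xs"
  define A where "A = prefix_sum U x B"
  have hom: "stufufuffle_hom a b B"
    using Cons by (simp add: B_def U_def Q_def)
  have B: "lin_ext series_scale B (stufufuffle_word a b v w) = B v * B w" for v w
    using hom by (simp add: stufufuffle_hom_def)
  have A: "lin_ext series_scale A (stufufuffle_word a b v w)
      = A v * A w + Q * ((A v - B v) * (A w - B w))" for v w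
    unfolding A_def U_def Q_def
    by (rule prefix_sum_stufufuffle[OF a b hom]) (simp add: B_def eta_alphabet_Nil)
  have eq: "eta_alphabet U Q (x # xs) = (\<lambda>w. A w - Q * (B w - A w))"
    by (rule ext) (simp add: A_def B_def Let_def algebra_simps)
  have "stufufuffle_hom a b (\<lambda>w. A w - Q * (B w - A w))"
    unfolding stufufuffle_hom_def lin_ext_diff lin_ext_times A B
    by (simp add: algebra_simps)
  then show ?case
    unfolding U_def[symmetric] Q_def[symmetric] eq .
qed


section \<open>Coefficients in a finite alphabet\<close>

text \<open>
  Including \<open>0\<close> and the total makes the recursion over the list uniform and the set
  insensitive to zero entries, so exponent vectors can be compared with compositions without
  removing their zeros.
\<close>

definition full_partial_sums :: "nat list \<Rightarrow> nat set" where
  "full_partial_sums \<alpha> = (\<lambda>i. sum_list (take i \<alpha>)) ` {..length \<alpha>}"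

definition coarsens :: "nat list \<Rightarrow> nat list \<Rightarrow> bool" where
  "coarsens \<epsilon> \<alpha> \<longleftrightarrow> sum_list \<epsilon> = sum_list \<alpha> \<and> full_partial_sums \<epsilon> \<subseteq> full_partial_sums \<alpha>"

lemma full_partial_sums_Nil [simp]: "full_partial_sums [] = {0}"
  by (simp add: full_partial_sums_def)

lemma full_partial_sums_Cons [simp]: "full_partial_sums (i # \<alpha>) = insert 0 ((+) i ` full_partial_sums \<alpha>)"
  by (simp add: full_partial_sums_def atMost_Suc_eq_insert_0 image_image)

lemma zero_in_full_partial_sums [simp]: "0 \<in> full_partial_sums \<alpha>"
  by (cases \<alpha>) auto

lemma full_partial_sums_filter: "full_partial_sums (filter (\<lambda>e. e \<noteq> 0) \<epsilon>) = full_partial_sums \<epsilon>"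
  by (induction \<epsilon>) (auto simp: insert_absorb)

lemma sum_list_filter_nonzero: "sum_list (filter (\<lambda>e. e \<noteq> 0) \<epsilon>) = sum_list (\<epsilon> :: nat list)"
  by (induction \<epsilon>) auto

lemma coarsens_Nil: "coarsens \<epsilon> [] \<longleftrightarrow> set \<epsilon> \<subseteq> {0}"
proof -
  have "full_partial_sums \<epsilon> = {0}" if "set \<epsilon> \<subseteq> {0}"
    using that by (induction \<epsilon>) auto
  then show ?thesis
    by (auto simp: coarsens_def)
qed

lemma coarsens_Cons_0: "coarsens (0 # \<epsilon>) \<alpha> \<longleftrightarrow> coarsens \<epsilon> \<alpha>"
  by (auto simp: coarsens_def)

text \<open>
  The smallest nonzero partial sums are \<open>e\<close> on the left and \<open>i\<close> on the right, so the first
  block of a coarsening must absorb the first letter entirely. This mirrors how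
  \<open>prefix_sum\<close> takes the factor \<open>x\<^sup>i\<close> off a monomial.
\<close>

lemma coarsens_Cons_Cons:
  assumes "0 < i" "0 < e"
  shows "coarsens (e # \<epsilon>) (i # \<alpha>) \<longleftrightarrow> i \<le> e \<and> coarsens ((e - i) # \<epsilon>) \<alpha>"
proof (cases "i \<le> e")
  case True
  then obtain d where e: "e = i + d"
    using le_Suc_ex by blast
  have "(+) e ` X \<subseteq> insert 0 ((+) i ` Y) \<longleftrightarrow> (+) d ` X \<subseteq> Y" for X Y
    using assms by (fastforce simp: e image_subset_iff)
  then show ?thesis
    by (auto simp: coarsens_def e)
next
  case False
  have "e \<in> full_partial_sums (e # \<epsilon>)"
    by (auto intro: rev_image_eqI)
  moreover have "e \<notin> full_partial_sums (i # \<alpha>)"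
    using False assms by auto
  ultimately show ?thesis
    using False unfolding coarsens_def by blast
qed


definition monomial :: "monom \<Rightarrow> 'k::{comm_ring, comm_monoid_mult} series" where
  "monomial p = Series (\<lambda>m. if m = p then 1 else 0)"

definition var :: "nat \<Rightarrow> 'k::{comm_ring, comm_monoid_mult} series" where
  "var i = monomial (Poly_Mapping.single i 1)"

lemma coeff_monomial: "coeff (monomial p) m = (if m = p then 1 else 0)"
  by (simp add: monomial_def)

lemma coeff_monomial_times: "coeff (monomial p * f) (p + m) = coeff f m"
proof -
  have "coeff (monomial p * f) (p + m)
      = (\<Sum>(m1, m2)\<in>{(p, m)}. coeff (monomial p) m1 * coeff f m2)"
    unfolding coeff_times
    by (rule sum.mono_neutral_right[OF finite_splits])
      (auto simp: splits_def coeff_monomial split: if_splits)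
  then show ?thesis
    by (simp add: coeff_monomial)
qed

lemma coeff_monomial_times_eq_0:
  assumes "\<And>m'. m \<noteq> p + m'"
  shows "coeff (monomial p * f) m = 0"
  unfolding coeff_times
  by (rule sum.neutral) (use assms in \<open>auto simp: splits_def coeff_monomial\<close>)

lemma monomial_times: "monomial p * monomial r = monomial (p + r)"
proof (rule series_eqI)
  fix m
  show "coeff (monomial p * monomial r) m = coeff (monomial (p + r)) m"
  proof (cases "\<exists>m'. m = p + m'")
    case True
    then show ?thesis
      by (auto simp: coeff_monomial_times coeff_monomial)
  next
    case False
    then show ?thesis
      by (subst coeff_monomial_times_eq_0) (auto simp: coeff_monomial)
  qed
qed

lemma var_power: "var i ^ e = monomial (Poly_Mapping.single i e)"
proof (induction e)
  case 0
  show ?case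
    by (rule series_eqI) (simp add: coeff_monomial)
next
  case (Suc e)
  then show ?case
    by (simp add: var_def monomial_times flip: single_add)
qed

lemma coeff_var_power_times:
  "coeff (var i ^ e * f) m =
     (if e \<le> lookup m i then coeff f (m - Poly_Mapping.single i e) else 0)"
proof (cases "e \<le> lookup m i")
  case True
  have "m = Poly_Mapping.single i e + (m - Poly_Mapping.single i e)"
    by (rule poly_mapping_eqI) (use True in \<open>auto simp: lookup_add lookup_minus lookup_single when_def\<close>)
  then show ?thesis
    using True coeff_monomial_times[of "Poly_Mapping.single i e" f] var_power by metis
next
  case False
  then have "m \<noteq> Poly_Mapping.single i e + m'" for m'
    by (auto simp: lookup_add)
  then show ?thesis
    using False unfolding var_power by (simp add: coeff_monomial_times_eq_0)
qed

text \<open>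
  The new variable \<open>g\<close> does not contribute to the power of \<open>q + 1\<close>; this is the only
  difference from the coefficients of \<open>eta_alphabet\<close> in the enlarged alphabet.
\<close>

lemma coeff_prefix_sum:
  fixes q u :: "'k::{comm_ring, comm_monoid_mult}"
  defines "U \<equiv> series_scale u 1"
  assumes coeff_B: "\<And>w m. w \<in> Comp \<Longrightarrow> coeff (B w) m =
      (if keys m \<subseteq> set is \<and> coarsens (map (lookup m) is) w
       then u ^ length w * (q + 1) ^ card (keys m) else 0)"
    and g: "g \<notin> set is"
    and w: "w \<in> Comp"
  shows "coeff (prefix_sum U (var g) B w) m =
      (if keys m \<subseteq> insert g (set is) \<and> coarsens (map (lookup m) (g # is)) w
       then u ^ length w * (q + 1) ^ card (keys m - {g}) else 0)"
  using w
proof (induction w arbitrary: m)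
  case Nil
  have iff: "keys m \<subseteq> set js \<and> coarsens (map (lookup m) js) [] \<longleftrightarrow> m = 0" for js
  proof
    assume "keys m \<subseteq> set js \<and> coarsens (map (lookup m) js) []"
    then show "m = 0"
      by (intro poly_mapping_eqI) (force simp: coarsens_Nil in_keys_iff)
  qed (auto simp: coarsens_Nil)
  have "keys m \<subseteq> insert g (set is) \<and> coarsens (map (lookup m) (g # is)) [] \<longleftrightarrow> m = 0"
    using iff[of "g # is"] by (simp only: list.set)
  then show ?case
    by (simp only: prefix_sum.simps coeff_B[OF Nil] iff) simp
next
  case (Cons i w)
  have i: "0 < i" and w: "w \<in> Comp"
    using Cons.prems by (auto simp: Comp_def)
  let ?e = "lookup m g"
  have U_times: "coeff (U * f) m = u * coeff f m" for f
    by (simp add: U_def flip: series_scale_eq_times)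
  \<comment> \<open>Only one of the two terms of the recursion contributes: a monomial without \<open>g\<close> comes from
    \<open>B\<close>, and one with \<open>g\<close> has its first letter absorbed by \<open>g\<close>.\<close>
  show ?case
  proof (cases "?e = 0")
    case True
    then have "g \<notin> keys m"
      by (simp add: in_keys_iff)
    then show ?thesis
      using True i coeff_B[OF Cons.prems, of m]
      by (auto simp: mult.assoc U_times coeff_var_power_times coarsens_Cons_0)
  next
    case False
    define m' where "m' = m - Poly_Mapping.single g i"
    have m': "lookup m' j = (if j = g then ?e - i else lookup m j)" for j
      by (simp add: m'_def lookup_minus lookup_single when_def)
    have map_m': "map (lookup m') is = map (lookup m) is"
      using g by (auto simp: m')
    have keys_m': "keys m' - {g} = keys m - {g}"
      by (auto simp: in_keys_iff m' split: if_splits)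
    have keys_iff: "keys m' \<subseteq> insert g (set is) \<longleftrightarrow> keys m \<subseteq> insert g (set is)"
      using keys_m' by auto
    have "g \<in> keys m"
      using False by (simp add: in_keys_iff)
    then have "coeff (B (i # w)) m = 0"
      using g coeff_B[OF Cons.prems, of m] by auto
    then have "coeff (prefix_sum U (var g) B (i # w)) m
        = (if i \<le> ?e then u * coeff (prefix_sum U (var g) B w) m' else 0)"
      by (simp add: mult.assoc U_times coeff_var_power_times m'_def)
    also have "\<dots> = (if keys m \<subseteq> insert g (set is) \<and> i \<le> ?e \<and> coarsens ((?e - i) # map (lookup m) is) w
         then u ^ length (i # w) * (q + 1) ^ card (keys m - {g}) else 0)"
      unfolding Cons.IH[OF w] keys_iff keys_m' list.map map_m' by (simp add: m' mult.assoc)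
    also have "(i \<le> ?e \<and> coarsens ((?e - i) # map (lookup m) is) w)
        \<longleftrightarrow> coarsens (map (lookup m) (g # is)) (i # w)"
      using coarsens_Cons_Cons[OF i, of ?e] False by simp
    finally show ?thesis .
  qed
qed

lemma coeff_eta_alphabet:
  fixes q u :: "'k::{comm_ring, comm_monoid_mult}"
  assumes "distinct is" "w \<in> Comp"
  shows "coeff (eta_alphabet (series_scale u 1) (series_scale q 1) (map var is) w) m =
      (if keys m \<subseteq> set is \<and> coarsens (map (lookup m) is) w
       then u ^ length w * (q + 1) ^ card (keys m) else 0)"
  using assms
proof (induction "is" arbitrary: w m)
  case Nil
  then show ?case
    by (cases w) (auto simp: coarsens_def Comp_def)
next
  case (Cons g "is")
  define B where "B = eta_alphabet (series_scale u 1) (series_scale q 1) (map var is)"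
  define A where "A = prefix_sum (series_scale u 1) (var g) B"
  have g: "g \<notin> set is"
    using Cons.prems by simp
  have coeff_B: "coeff (B w) m =
      (if keys m \<subseteq> set is \<and> coarsens (map (lookup m) is) w
       then u ^ length w * (q + 1) ^ card (keys m) else 0)" if "w \<in> Comp" for w m
    unfolding B_def using Cons that by simp
  note coeff_A = coeff_prefix_sum[OF coeff_B g \<open>w \<in> Comp\<close>, folded A_def, of m]
  have "coeff (eta_alphabet (series_scale u 1) (series_scale q 1) (map var (g # is)) w) m
      = coeff (A w) m + q * (coeff (A w) m - coeff (B w) m)"
    by (simp add: A_def B_def Let_def flip: series_scale_eq_times)
  also have "\<dots> = (if keys m \<subseteq> set (g # is) \<and> coarsens (map (lookup m) (g # is)) w
       then u ^ length w * (q + 1) ^ card (keys m) else 0)"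
  proof (cases "g \<in> keys m")
    case True
    then have "(q + 1) ^ card (keys m) = (q + 1) * (q + 1) ^ card (keys m - {g})"
      by (metis card_Suc_Diff1 finite_keys power_Suc)
    then show ?thesis
      using True g coeff_A coeff_B[OF \<open>w \<in> Comp\<close>, of m] by (auto simp: algebra_simps)
  next
    case False
    then have "lookup m g = 0"
      by (simp add: in_keys_iff)
    then show ?thesis
      using False coeff_A coeff_B[OF \<open>w \<in> Comp\<close>, of m]
      by (auto simp: coarsens_Cons_0)
  qed
  finally show ?case .
qed

section \<open>Coefficients of quasisymmetric functions\<close>

definition exponents :: "monom \<Rightarrow> nat list" where
  "exponents m = map (lookup m) (sorted_list_of_set (keys m))"

lemma lookup_monom_of_map:
  assumes "distinct is"
  shows "lookup (monom_of is (map h is)) j = (if j \<in> set is then h j else 0)"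
  using assms
  by (induction "is") (auto simp: monom_of_def lookup_add lookup_single when_def)

lemma lookup_monom_of:
  assumes "distinct is" "length is = length \<alpha>"
  shows "map (lookup (monom_of is \<alpha>)) is = \<alpha>"
  using assms(2,1)
proof (induction "is" \<alpha> rule: list_induct2)
  case (Cons i "is" e \<alpha>)
  have eq: "monom_of (i # is) (e # \<alpha>) = Poly_Mapping.single i e + monom_of is \<alpha>"
    by (simp add: monom_of_def)
  have "lookup (monom_of is \<alpha>) i = 0"
    using lookup_monom_of_map[of "is" "lookup (monom_of is \<alpha>)" i] Cons by simp
  moreover have "map (lookup (monom_of (i # is) (e # \<alpha>))) is = map (lookup (monom_of is \<alpha>)) is"
    using Cons.prems by (auto simp: eq lookup_add lookup_single when_def)
  then have "map (lookup (monom_of (i # is) (e # \<alpha>))) is = \<alpha>"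
    using Cons.IH Cons.prems by (metis distinct.simps(2))
  moreover have "lookup (monom_of (i # is) (e # \<alpha>)) i = e + lookup (monom_of is \<alpha>) i"
    by (simp add: eq lookup_add)
  ultimately show ?case
    using Cons by simp
qed simp

text \<open>
  A monomial occurs in exactly one monomial quasisymmetric function, the one indexed by its
  exponents in increasing order of the variables.
\<close>

lemma coeff_M:
  assumes "\<beta> \<in> Comp"
  shows "coeff (M \<beta>) m = (if \<beta> = exponents m then 1 else 0)"
proof -
  have "(\<exists>is. length is = length \<beta> \<and> sorted_wrt (<) is \<and> m = monom_of is \<beta>)
      \<longleftrightarrow> \<beta> = exponents m" (is "?L \<longleftrightarrow> ?R")
  proof
    assume ?L
    then obtain "is" where *: "length is = length \<beta>" "sorted_wrt (<) is" "m = monom_of is \<beta>"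
      by blast
    then have "sorted_list_of_set (keys m) = is"
      using keys_monom_of[OF assms *(1)]
      by (metis strict_sorted_iff sorted_list_of_set.idem_if_sorted_distinct)
    moreover have "distinct is"
      using * strict_sorted_iff by blast
    ultimately show ?R
      using * lookup_monom_of[of "is" \<beta>] by (auto simp: exponents_def)
  next
    assume R: ?R
    let ?is = "sorted_list_of_set (keys m)"
    have "m = monom_of ?is (exponents m)"
      unfolding exponents_def
      by (rule poly_mapping_eqI) (simp add: lookup_monom_of_map in_keys_iff)
    then show ?L
      using R by (intro exI[of _ ?is]) (simp add: exponents_def)
  qed
  then show ?thesis
    by (simp add: M_def)
qed

lemma exponents_Comp: "exponents m \<in> Comp"
  by (auto simp: exponents_def Comp_def in_keys_iff)

lemma exponents_eq_filter:
  assumes "keys m \<subseteq> {..<N}"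
  shows "exponents m = filter (\<lambda>e. e \<noteq> 0) (map (lookup m) [0..<N])"
proof -
  have "sorted_list_of_set (keys m) = filter (\<lambda>i. i \<in> keys m) [0..<N]"
    by (rule sorted_distinct_set_unique) (use assms in \<open>auto simp: sorted_wrt_filter\<close>)
  then show ?thesis
    by (simp add: exponents_def filter_map o_def in_keys_iff)
qed

text \<open>
  Positivity makes the partial sums strictly increase, so no inner one equals \<open>0\<close> or the
  total.
\<close>

lemma partial_sums_eq:
  assumes "\<alpha> \<in> Comp"
  shows "partial_sums \<alpha> = full_partial_sums \<alpha> - {0, sum_list \<alpha>}"
proof -
  have inner: "sum_list (take i \<alpha>) \<noteq> 0 \<and> sum_list (take i \<alpha>) \<noteq> sum_list \<alpha>"
    if "0 < i" "i < length \<alpha>" for i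
  proof -
    have "set (take i \<alpha>) \<noteq> {}" "set (drop i \<alpha>) \<noteq> {}" "0 \<notin> set (take i \<alpha>)" "0 \<notin> set (drop i \<alpha>)"
      using that assms set_take_subset[of i \<alpha>] set_drop_subset[of i \<alpha>] by (auto simp: Comp_def)
    then have "sum_list (take i \<alpha>) \<noteq> 0" "sum_list (drop i \<alpha>) \<noteq> 0"
      unfolding sum_list_eq_0_iff by (metis ex_in_conv)+
    moreover have "sum_list \<alpha> = sum_list (take i \<alpha>) + sum_list (drop i \<alpha>)"
      by (simp flip: sum_list_append)
    ultimately show ?thesis
      by simp
  qed
  have "full_partial_sums \<alpha> - {0, sum_list \<alpha>}
      = (\<lambda>i. sum_list (take i \<alpha>)) ` {i. 0 < i \<and> i < length \<alpha>}"
  proof (intro equalityI subsetI)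
    fix s
    assume "s \<in> full_partial_sums \<alpha> - {0, sum_list \<alpha>}"
    then obtain i where i: "s = sum_list (take i \<alpha>)" "i \<le> length \<alpha>" "s \<noteq> 0" "s \<noteq> sum_list \<alpha>"
      unfolding full_partial_sums_def by blast
    then have "i \<noteq> 0" "i \<noteq> length \<alpha>"
      by (metis take_0 sum_list.Nil, metis take_all order_refl)
    then show "s \<in> (\<lambda>i. sum_list (take i \<alpha>)) ` {i. 0 < i \<and> i < length \<alpha>}"
      using i by auto
  next
    fix s
    assume "s \<in> (\<lambda>i. sum_list (take i \<alpha>)) ` {i. 0 < i \<and> i < length \<alpha>}"
    then obtain i where "s = sum_list (take i \<alpha>)" "0 < i" "i < length \<alpha>"
      by auto
    with inner[of i] show "s \<in> full_partial_sums \<alpha> - {0, sum_list \<alpha>}"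
      unfolding full_partial_sums_def by auto
  qed
  also have "{i. 0 < i \<and> i < length \<alpha>} = {1..length \<alpha> - 1}"
    by auto
  finally show ?thesis
    by (auto simp: partial_sums_def)
qed

lemma coarsens_iff:
  assumes "\<beta> \<in> Comp" "\<alpha> \<in> Comp"
  shows "coarsens \<beta> \<alpha> \<longleftrightarrow> \<beta> \<in> Comp_of_size (sum_list \<alpha>) \<and> partial_sums \<beta> \<subseteq> partial_sums \<alpha>"
proof -
  have "sum_list \<gamma> \<in> full_partial_sums \<gamma>" for \<gamma>
    by (induction \<gamma>) auto
  then show ?thesis
    using assms by (auto simp: coarsens_def Comp_of_size_def partial_sums_eq)
qed

lemma coeff_eta_qsym:
  assumes "\<alpha> \<in> Comp"
  shows "coeff (eta_qsym q \<alpha>) m = (if coarsens (exponents m) \<alpha> then (q + 1) ^ card (keys m) else 0)"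
proof -
  let ?S = "{\<beta> \<in> Comp_of_size (sum_list \<alpha>). partial_sums \<beta> \<subseteq> partial_sums \<alpha>}"
  have "coeff (eta_qsym q \<alpha>) m = (\<Sum>\<beta>\<in>?S. if \<beta> = exponents m then (q + 1) ^ length \<beta> else 0)"
    unfolding eta_qsym_def coeff_sum
    by (rule sum.cong) (auto simp: coeff_M Comp_of_size_def)
  also have "\<dots> = (if exponents m \<in> ?S then (q + 1) ^ length (exponents m) else 0)"
    by (simp add: finite_Comp_of_size)
  finally show ?thesis
    using coarsens_iff[OF exponents_Comp assms] by (simp add: exponents_def)
qed

text \<open>
  Both coefficients depend only on whether the exponents of the monomial coarsen \<open>\<alpha>\<close>; on the
  side of the finite alphabet the exponent vector also has zero entries, which change nothing.
\<close>

lemma coeff_eta_word_eq_alphabet: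
  assumes "\<alpha> \<in> Comp" "keys m \<subseteq> {..<N}"
  shows "coeff (series_scale (u ^ length \<alpha>) (eta_qsym q \<alpha>)) m =
    coeff (eta_alphabet (series_scale u 1) (series_scale q 1) (map var [0..<N]) \<alpha>) m"
proof -
  have "coarsens (exponents m) \<alpha> \<longleftrightarrow> coarsens (map (lookup m) [0..<N]) \<alpha>"
    by (simp only: exponents_eq_filter[OF assms(2)] coarsens_def full_partial_sums_filter
        sum_list_filter_nonzero)
  then show ?thesis
    using assms by (subst coeff_eta_alphabet) (auto simp: coeff_eta_qsym)
qed



section \<open>The homomorphism\<close>

lemma word_free_alg: "\<gamma> \<in> Comp \<Longrightarrow> word \<gamma> \<in> free_alg"
  by (auto simp: free_alg_def word_def)

lemma zero_free_alg: "0 \<in> free_alg"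
  by (simp add: free_alg_def)

lemma add_free_alg: "f \<in> free_alg \<Longrightarrow> g \<in> free_alg \<Longrightarrow> f + g \<in> free_alg"
  using Poly_Mapping.keys_add[of f g] by (auto simp: free_alg_def)

lemma scale_free_alg: "f \<in> free_alg \<Longrightarrow> scale c f \<in> free_alg"
  by (force simp: free_alg_def in_keys_iff)

lemma lin_ext_free_alg:
  assumes "f \<in> free_alg" "\<And>\<gamma>. \<gamma> \<in> Comp \<Longrightarrow> h \<gamma> \<in> free_alg"
  shows "lin_ext scale h f \<in> free_alg"
proof -
  have "(\<Sum>\<gamma>\<in>S. scale (lookup f \<gamma>) (h \<gamma>)) \<in> free_alg" if "S \<subseteq> Comp" for S
    using that by (induction S rule: infinite_finite_induct)
      (auto simp: zero_free_alg intro!: add_free_alg scale_free_alg assms(2))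
  then show ?thesis
    using assms(1) by (simp add: lin_ext_def free_alg_def)
qed

text \<open>
  The comparison of coefficients with a finite alphabet is valid for words with positive
  letters, so it has to be known that no other words occur in a stufufuffle.
\<close>

lemma stufufuffle_word_free_alg:
  "v \<in> Comp \<Longrightarrow> w \<in> Comp \<Longrightarrow> stufufuffle_word a b v w \<in> free_alg"
proof (induction a b v w rule: stufufuffle_word.induct)
  case (3 a b i v j w)
  have "letter k \<cdot> f \<in> free_alg" if "0 < k" "f \<in> free_alg" for k and f :: "'a words"
    unfolding letter_conc
    by (rule lin_ext_free_alg) (use that in \<open>auto intro!: word_free_alg simp: Comp_def\<close>)
  moreover have "zeta_word k \<gamma> \<in> free_alg" if "\<gamma> \<in> Comp" for k \<gamma>
    using that by (cases \<gamma>) (auto intro!: word_free_alg simp: zero_free_alg Comp_def)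
  then have "zeta k f \<in> free_alg" if "f \<in> free_alg" for k and f :: "'a words"
    unfolding zeta_def using that by (rule lin_ext_free_alg[rotated])
  ultimately show ?case
    using 3 by (auto simp: Comp_def intro!: add_free_alg scale_free_alg)
qed (auto intro: word_free_alg)

lemma eta_stufufuffle_word:
  fixes a b q u :: "'k::{comm_ring, comm_monoid_mult}"
  assumes a: "a = (q - 1) * u" and b: "b = - q * u ^ 2" and v: "v \<in> Comp" and w: "w \<in> Comp"
  shows "eta q u (stufufuffle_word a b v w) = eta q u (word v) * eta q u (word w)"
proof (rule series_eqI)
  fix m :: monom
  \<comment> \<open>The first \<open>N\<close> variables suffice for \<open>m\<close> and for all its factors.\<close>
  obtain N where "\<forall>i\<in>keys m. i < N"
    using finite_nat_set_iff_bounded[of "keys m"] finite_keys[of m] by blast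
  then have N: "keys m \<subseteq> {..<N}"
    by auto
  define E where "E = eta_alphabet (series_scale u 1) (series_scale q 1) (map var [0..<N])"
  have word: "coeff (eta q u (word \<alpha>)) m' = coeff (E \<alpha>) m'"
    if "\<alpha> \<in> Comp" "keys m' \<subseteq> {..<N}" for \<alpha> m'
    unfolding eta_word E_def by (rule coeff_eta_word_eq_alphabet[OF that])
  have "keys (stufufuffle_word a b v w) \<subseteq> Comp"
    using stufufuffle_word_free_alg[OF v w] by (simp add: free_alg_def)
  then have "coeff (eta q u (stufufuffle_word a b v w)) m
      = coeff (lin_ext series_scale E (stufufuffle_word a b v w)) m"
    unfolding eta_def lin_ext_def coeff_sum
    using word N by (intro sum.cong) (auto simp: eta_word)
  also have "\<dots> = coeff (E v * E w) m"
    using stufufuffle_hom_eta_alphabet[OF a b] by (simp add: stufufuffle_hom_def E_def)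
  also have "\<dots> = coeff (eta q u (word v) * eta q u (word w)) m"
    unfolding coeff_times
  proof (intro sum.cong refl, clarsimp)
    fix m1 m2
    assume "(m1, m2) \<in> splits m"
    then have "keys m1 \<subseteq> keys m" "keys m2 \<subseteq> keys m"
      by (auto simp: splits_def in_keys_iff lookup_add)
    then show "coeff (E v) m1 * coeff (E w) m2
        = coeff (eta q u (word v)) m1 * coeff (eta q u (word w)) m2"
      using word v w N by (metis order_trans)
  qed
  finally show "coeff (eta q u (stufufuffle_word a b v w)) m
      = coeff (eta q u (word v) * eta q u (word w)) m" .
qed

lemma eta_stufufuffle:
  fixes a b q u :: "'k::{comm_ring, comm_monoid_mult}"
  assumes a: "a = (q - 1) * u" and b: "b = - q * u ^ 2" and f: "f \<in> free_alg" and g: "g \<in> free_alg"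
  shows "eta q u (stufufuffle a b f g) = eta q u f * eta q u g"
proof -
  have eta_lin_ext: "eta q u (lin_ext scale h f') = lin_ext series_scale (\<lambda>\<gamma>. eta q u (h \<gamma>)) f'"
    for h f'
    by (simp add: eta_def series.lin_ext_lin_ext)
  have eta_eq: "eta q u f' = lin_ext series_scale (\<lambda>\<gamma>. eta q u (word \<gamma>)) f'" for f'
    by (simp add: eta_def)
  have "eta q u (stufufuffle a b f g) =
      lin_ext series_scale (\<lambda>v. lin_ext series_scale
        (\<lambda>w. eta q u (stufufuffle_word a b v w)) g) f"
    by (simp add: stufufuffle_def bilin_ext_def eta_lin_ext)
  also have "\<dots> = lin_ext series_scale (\<lambda>v. lin_ext series_scale
        (\<lambda>w. eta q u (word v) * eta q u (word w)) g) f"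
    using f g by (intro lin_ext_cong eta_stufufuffle_word[OF a b]) (auto simp: free_alg_def)
  also have "\<dots> = lin_ext series_scale (\<lambda>v. eta q u g * eta q u (word v)) f"
    by (simp add: lin_ext_times mult.commute flip: eta_eq)
  also have "\<dots> = eta q u f * eta q u g"
    by (simp add: lin_ext_times mult.commute flip: eta_eq)
  finally show ?thesis .
qed

lemma zero_QSym: "0 \<in> QSym"
  unfolding QSym_def by (intro CollectI exI[of _ "{}"]) auto

lemma add_QSym:
  assumes "f \<in> QSym" "g \<in> QSym"
  shows "f + g \<in> QSym"
proof -
  obtain A c B d where f: "f = (\<Sum>\<alpha>\<in>A. series_scale (c \<alpha>) (M \<alpha>))" "finite A" "A \<subseteq> Comp"
    and g: "g = (\<Sum>\<alpha>\<in>B. series_scale (d \<alpha>) (M \<alpha>))" "finite B" "B \<subseteq> Comp"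
    using assms unfolding QSym_def by blast
  define e where "e \<alpha> = (if \<alpha> \<in> A then c \<alpha> else 0) + (if \<alpha> \<in> B then d \<alpha> else 0)" for \<alpha>
  have "f = (\<Sum>\<alpha>\<in>A \<union> B. series_scale (if \<alpha> \<in> A then c \<alpha> else 0) (M \<alpha>))"
    unfolding f by (rule sum.mono_neutral_cong_left) (use f g in auto)
  moreover have "g = (\<Sum>\<alpha>\<in>A \<union> B. series_scale (if \<alpha> \<in> B then d \<alpha> else 0) (M \<alpha>))"
    unfolding g by (rule sum.mono_neutral_cong_left) (use f g in auto)
  ultimately have "f + g = (\<Sum>\<alpha>\<in>A \<union> B. series_scale (e \<alpha>) (M \<alpha>))"
    by (simp only: e_def series.sc_add_left sum.distrib)
  then show ?thesis
    unfolding QSym_def using f g by (intro CollectI exI[of _ "A \<union> B"] exI[of _ e]) auto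
qed

lemma sum_QSym: "(\<And>x. x \<in> A \<Longrightarrow> h x \<in> QSym) \<Longrightarrow> sum h A \<in> QSym"
  by (induction A rule: infinite_finite_induct) (auto simp: zero_QSym add_QSym)

lemma scale_M_QSym: "\<alpha> \<in> Comp \<Longrightarrow> series_scale c (M \<alpha>) \<in> QSym"
  unfolding QSym_def by (intro CollectI exI[of _ "{\<alpha>}"] exI[of _ "\<lambda>_. c"]) auto

lemma eta_QSym: "eta q u f \<in> QSym"
  unfolding eta_def lin_ext_def eta_qsym_def
  by (auto simp: series.sc_sum Comp_of_size_def simp flip: series.sc_mult
      intro!: sum_QSym scale_M_QSym)

lemma eta_one: "eta q u (word []) = 1"
proof (rule series_eqI)
  fix m
  have "exponents m = [] \<longleftrightarrow> m = 0"
    by (simp add: exponents_def)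
  moreover have "set (exponents m) \<subseteq> {0} \<longleftrightarrow> exponents m = []"
    using exponents_Comp[of m] by (cases "exponents m") (auto simp: Comp_def)
  ultimately show "coeff (eta q u (word [])) m = coeff 1 m"
    by (simp add: eta_word coeff_eta_qsym Comp_def coarsens_Nil)
qed

theorem theorem6p13:
  fixes a b q u :: "'k::{comm_ring, comm_monoid_mult}"
  assumes "a = (q - 1) * u" and "b = - q * u ^ 2"
  shows "algebra_hom free_alg scale (stufufuffle a b) (word [])
                     QSym series_scale (*) 1 (eta q u)"
  unfolding algebra_hom_def
  using eta_QSym eta_one eta_stufufuffle[OF assms]
  by (auto simp: eta_def series.lin_ext_add series.lin_ext_scale)

end
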